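(* Every self-adjoint complex Hadamard matrix of order $6$ has a $2$-circulant representation.
   Context: A complex Hadamard matrix of order $n$ is an $n\times n$ matrix $H$ with all entries of modulus $1$ and $HH^\ast=nI_n$. Two complex Hadamard matrices $H,K$ are equivalent if $H=D_1PKQD_2$ for some unitary diagonal matrices $D_1,D_2$ and permutation matrices $P,Q$. A $3\times3$ matrix is circulant if it is of the form $\begin{bmatrix} a & b & c \\ c & a & b \\ b & c & a \end{bmatrix}$. A $6\times6$ matrix is $2$-circulant if, written as a $2\times2$ block matrix with $3\times 3$ blocks, each of its four blocks is circulant. A complex Hadamard matrix of order $6$ has a $2$-circulant representation if it is equivalent to a $2$-circulant complex Hadamard matrix. *)

theory Defs
  imports "Jordan_Normal_Form.Schur_Decomposition" "HOL-Combinatorics.Permutations"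
begin

definition complex_hadamard :: "nat \<Rightarrow> complex mat \<Rightarrow> bool" where
  "complex_hadamard n H \<longleftrightarrow>
     H \<in> carrier_mat n n \<and>
     (\<forall>i<n. \<forall>j<n. cmod (H $$ (i, j)) = 1) \<and>
     H * mat_adjoint H = of_nat n \<cdot>\<^sub>m 1\<^sub>m n"

definition unitary_diagonal :: "nat \<Rightarrow> complex mat \<Rightarrow> bool" where
  "unitary_diagonal n D \<longleftrightarrow>
     D \<in> carrier_mat n n \<and> diagonal_mat D \<and> D * mat_adjoint D = 1\<^sub>m n"

definition permutation_matrix :: "nat \<Rightarrow> complex mat \<Rightarrow> bool" where
  "permutation_matrix n P \<longleftrightarrow>
     (\<exists>p. p permutes {..<n} \<and> P = mat n n (\<lambda>(i, j). if i = p j then 1 else 0))"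

definition hadamard_equivalent :: "nat \<Rightarrow> complex mat \<Rightarrow> complex mat \<Rightarrow> bool" where
  "hadamard_equivalent n H K \<longleftrightarrow>
     (\<exists>D1 P Q D2.
        unitary_diagonal n D1 \<and> unitary_diagonal n D2 \<and>
        permutation_matrix n P \<and> permutation_matrix n Q \<and>
        H = D1 * P * K * Q * D2)"

definition circulant3 :: "complex mat \<Rightarrow> bool" where
  "circulant3 A \<longleftrightarrow>
     (\<exists>a b c. A = mat_of_rows_list 3 [[a, b, c], [c, a, b], [b, c, a]])"

definition two_circulant :: "complex mat \<Rightarrow> bool" where
  "two_circulant K \<longleftrightarrow>
     (\<exists>A B C D. circulant3 A \<and> circulant3 B \<and> circulant3 C \<and> circulant3 D \<and>
        K = four_block_mat A B C D)"

definition has_two_circulant_representation :: "complex mat \<Rightarrow> bool" where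
  "has_two_circulant_representation H \<longleftrightarrow>
     (\<exists>K. complex_hadamard 6 K \<and> two_circulant K \<and> hadamard_equivalent 6 H K)"

end

theory Submission
  imports Defs
begin

text \<open>Since \<open>H\<^sup>2 = 6\<close>, the integer trace of \<open>H\<close> is an integer multiple of \<open>sqrt 6\<close>, hence \<open>0\<close>, and
  a permutation brings the diagonal to \<open>(1, 1, 1, -1, -1, -1)\<close>. Write \<open>H\<close> in blocks \<open>A\<close>, \<open>B\<close>, \<open>B*\<close>, \<open>C\<close>;
  then \<open>A B = - B C\<close> and \<open>B B* = 6 - A\<^sup>2\<close>. Comparing traces of cubes shows that the cyclic products
  \<open>h\<^sub>0\<^sub>1 h\<^sub>1\<^sub>2 h\<^sub>2\<^sub>0\<close> and \<open>h\<^sub>3\<^sub>4 h\<^sub>4\<^sub>5 h\<^sub>5\<^sub>3\<close> of \<open>A\<close> and \<open>C\<close> have opposite real parts. If \<open>u\<close> is a cube root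
  of the first one, rescaling by phases (and possibly swapping two indices) turns \<open>A\<close> into the circulant
  matrix with first row \<open>(1, u, cnj u)\<close> and \<open>C\<close> into \<open>- A\<close>, so \<open>B\<close> commutes with \<open>A\<close>. If \<open>u\<^sup>6 \<noteq> 1\<close>, this
  forces \<open>B\<close> to be circulant. Otherwise \<open>u\<close> may be taken to be \<open>1\<close> or \<open>-1\<close>. The value \<open>1\<close> contradicts
  \<open>B B* \<ge> 0\<close>; for \<open>-1\<close> all rows of \<open>B\<close> turn out to be permutations of one triple \<open>(a, a, b)\<close>, and a
  permutation of the first three indices makes \<open>B\<close> circulant.\<close>

section \<open>Matrix entries and the trace of a square root of a scalar matrix\<close>

lemma index_mat_adjoint:
  fixes A :: "complex mat"
  assumes "i < dim_col A" "j < dim_row A"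
  shows "mat_adjoint A $$ (i, j) = cnj (A $$ (j, i))"
  using assms unfolding mat_adjoint_def by (simp add: mat_of_rows_def)

lemma dim_mat_adjoint [simp]:
  fixes A :: "complex mat"
  shows "dim_row (mat_adjoint A) = dim_col A" "dim_col (mat_adjoint A) = dim_row A"
  unfolding mat_adjoint_def by auto

lemma index_mult_mat_sum:
  assumes "A \<in> carrier_mat n m" "B \<in> carrier_mat m l" "i < n" "j < l"
  shows "(A * B) $$ (i, j) = (\<Sum>k<m. A $$ (i, k) * B $$ (k, j))"
  using assms by (auto simp: scalar_prod_def lessThan_atLeast0)

lemma sum_diag_mult_commute:
  fixes A B :: "'a::comm_semiring_0 mat"
  assumes "A \<in> carrier_mat n n" "B \<in> carrier_mat n n"
  shows "(\<Sum>i<n. (A * B) $$ (i, i)) = (\<Sum>i<n. (B * A) $$ (i, i))"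
proof -
  have "(\<Sum>i<n. (A * B) $$ (i, i)) = (\<Sum>i<n. \<Sum>k<n. A $$ (i, k) * B $$ (k, i))"
    using assms by (simp add: index_mult_mat_sum[of _ n n _ n] del: index_mult_mat)
  also have "\<dots> = (\<Sum>k<n. \<Sum>i<n. B $$ (k, i) * A $$ (i, k))"
    by (subst sum.swap) (simp add: mult.commute)
  also have "\<dots> = (\<Sum>k<n. (B * A) $$ (k, k))"
    using assms by (simp add: index_mult_mat_sum[of _ n n _ n] del: index_mult_mat)
  finally show ?thesis .
qed

text \<open>The trace is read off a triangular matrix \<open>B\<close> similar to \<open>A\<close>.
  Similarity carries the relation for \<open>A * A\<close> over to \<open>B\<close>, so every
  diagonal entry of \<open>B\<close> is \<open>c\<close> or \<open>- c\<close>.\<close>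

lemma sum_diag_sqrt_scalar:
  fixes A :: "complex mat"
  assumes A: "A \<in> carrier_mat n n" and sq: "A * A = c\<^sup>2 \<cdot>\<^sub>m 1\<^sub>m n"
  shows "\<exists>k::int. (\<Sum>i<n. A $$ (i, i)) = of_int k * c"
proof -
  from char_poly_factorized[OF A] obtain es where "char_poly A = (\<Prod>a\<leftarrow>es. [:- a, 1:])" by auto
  from schur_decomposition_exists[OF A this] obtain B where
    B: "B \<in> carrier_mat n n" and ut: "upper_triangular B" and sim: "similar_mat A B" by auto
  from sim A obtain P Q where P: "P \<in> carrier_mat n n" and Q: "Q \<in> carrier_mat n n"
    and QP: "Q * P = 1\<^sub>m n" and PQ: "P * Q = 1\<^sub>m n" and AB: "A = P * B * Q"
    by (auto simp: similar_mat_def similar_mat_wit_def Let_def)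
  note car = A B P Q
  have BQAP: "B = Q * A * P"
  proof -
    have "Q * A * P = (Q * P) * B * (Q * P)"
      unfolding AB using car by (simp add: assoc_mult_mat[of _ n n _ n _ n])
    then show ?thesis using QP B by simp
  qed
  have "(\<Sum>i<n. A $$ (i, i)) = (\<Sum>i<n. (P * (B * Q)) $$ (i, i))"
    unfolding AB using car by (simp add: assoc_mult_mat[of _ n n _ n _ n])
  also have "\<dots> = (\<Sum>i<n. ((B * Q) * P) $$ (i, i))"
    using car by (intro sum_diag_mult_commute) auto
  also have "(B * Q) * P = B"
    using car QP by (simp add: assoc_mult_mat[of _ n n _ n _ n])
  finally have tr: "(\<Sum>i<n. A $$ (i, i)) = (\<Sum>i<n. B $$ (i, i))" .
  have "B * B = Q * (A * A) * P"
  proof -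
    have "B * B = Q * A * (P * Q) * (A * P)"
      unfolding BQAP using car by (simp add: assoc_mult_mat[of _ n n _ n _ n])
    also have "\<dots> = Q * (A * A) * P"
      unfolding PQ using car by (simp add: assoc_mult_mat[of _ n n _ n _ n])
    finally show ?thesis .
  qed
  also have "\<dots> = c\<^sup>2 \<cdot>\<^sub>m 1\<^sub>m n"
  proof -
    have "Q * (c\<^sup>2 \<cdot>\<^sub>m 1\<^sub>m n) * P = c\<^sup>2 \<cdot>\<^sub>m (Q * P)"
      using P Q by (simp add: mult_smult_distrib[of _ n n _ n] mult_smult_assoc_mat[of _ n n _ n])
    then show ?thesis unfolding sq QP .
  qed
  finally have BB: "B * B = c\<^sup>2 \<cdot>\<^sub>m 1\<^sub>m n" .
  have diag: "B $$ (i, i) = c \<or> B $$ (i, i) = - c" if i: "i < n" for i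
  proof -
    have "c\<^sup>2 = (B * B) $$ (i, i)" unfolding BB using i by simp
    also have "\<dots> = (\<Sum>k<n. B $$ (i, k) * B $$ (k, i))"
      using B B i i by (rule index_mult_mat_sum)
    \<comment> \<open>For \<open>k\<close> different from \<open>i\<close>, one of the entries at
      \<open>(i, k)\<close> and \<open>(k, i)\<close> lies below the diagonal and vanishes.\<close>
    also have "\<dots> = (\<Sum>k\<in>{i}. B $$ (i, k) * B $$ (k, i))"
    proof (rule sum.mono_neutral_right)
      show "\<forall>k\<in>{..<n} - {i}. B $$ (i, k) * B $$ (k, i) = 0"
      proof
        fix k assume "k \<in> {..<n} - {i}"
        then have "k < i \<or> i < k \<and> k < n" by auto
        then show "B $$ (i, k) * B $$ (k, i) = 0"
          using ut B i by (auto simp: upper_triangular_def)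
      qed
    qed (use i in auto)
    finally show ?thesis by (simp add: power2_eq_square square_eq_iff) (metis square_eq_iff)
  qed
  \<comment> \<open>Partial sums with \<open>m \<le> n\<close> make induction possible, since
    \<open>diag\<close> speaks only of indices below \<open>n\<close>.\<close>
  have "\<exists>k::int. (\<Sum>i<m. B $$ (i, i)) = of_int k * c" if "m \<le> n" for m
    using that
  proof (induction m)
    case 0
    then show ?case by (auto intro: exI[of _ 0])
  next
    case (Suc m)
    then obtain k :: int where k: "(\<Sum>i<m. B $$ (i, i)) = of_int k * c" by auto
    from diag[of m] Suc.prems show ?case
      by (auto simp: k algebra_simps intro: exI[of _ "k + 1"] exI[of _ "k - 1"])
  qed
  then show ?thesis unfolding tr by blast
qed

section \<open>Hermitian Hadamard matrices as index functions, up to phases and permutations\<close>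

text \<open>Plain index functions turn permuting and rescaling into composition and multiplication.
  As the matrix is Hermitian, orthogonality of the rows is stated through its square, without an
  adjoint.\<close>

definition hermitian_hadamard :: "nat \<Rightarrow> (nat \<Rightarrow> nat \<Rightarrow> complex) \<Rightarrow> bool" where
  "hermitian_hadamard n h \<longleftrightarrow> (\<forall>i<n. \<forall>j<n. h j i = cnj (h i j) \<and> cmod (h i j) = 1 \<and>
     (\<Sum>k<n. h i k * h k j) = (if i = j then of_nat n else 0))"

lemma hermitian_hadamardD:
  assumes "hermitian_hadamard n h" "i < n" "j < n"
  shows "h j i = cnj (h i j)" "cmod (h i j) = 1"
    "(\<Sum>k<n. h i k * h k j) = (if i = j then of_nat n else 0)"
  using assms unfolding hermitian_hadamard_def by blast+

text \<open>The same permutation and conjugate phases act on rows and columns. Unlike general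
  Hadamard equivalence, this preserves being Hermitian.\<close>

definition phase_perm_congruent :: "nat \<Rightarrow> (nat \<Rightarrow> nat \<Rightarrow> complex) \<Rightarrow> (nat \<Rightarrow> nat \<Rightarrow> complex) \<Rightarrow> bool" where
  "phase_perm_congruent n h g \<longleftrightarrow> (\<exists>p d. p permutes {..<n} \<and> (\<forall>i<n. cmod (d i) = 1) \<and>
     (\<forall>i<n. \<forall>j<n. g i j = d i * h (p i) (p j) * cnj (d j)))"

lemma phase_perm_congruent_trans:
  assumes "phase_perm_congruent n f g" "phase_perm_congruent n g h"
  shows "phase_perm_congruent n f h"
proof -
  from assms(1) obtain p d where p: "p permutes {..<n}" and d: "\<forall>i<n. cmod (d i) = 1"
    and g: "\<forall>i<n. \<forall>j<n. g i j = d i * f (p i) (p j) * cnj (d j)"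
    unfolding phase_perm_congruent_def by auto
  from assms(2) obtain q e where q: "q permutes {..<n}" and e: "\<forall>i<n. cmod (e i) = 1"
    and h: "\<forall>i<n. \<forall>j<n. h i j = e i * g (q i) (q j) * cnj (e j)"
    unfolding phase_perm_congruent_def by auto
  have ql: "q i < n" if "i < n" for i using permutes_in_image[OF q, of i] that by simp
  show ?thesis unfolding phase_perm_congruent_def
  proof (intro exI conjI)
    show "(p \<circ> q) permutes {..<n}" using q p by (rule permutes_compose)
    show "\<forall>i<n. cmod (e i * d (q i)) = 1" using d e ql by (simp add: norm_mult)
    show "\<forall>i<n. \<forall>j<n. h i j = (e i * d (q i)) * f ((p \<circ> q) i) ((p \<circ> q) j) * cnj (e j * d (q j))"
      using h g ql by (simp add: algebra_simps)
  qed
qed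

lemma phase_perm_congruent_permute:
  assumes "p permutes {..<n}"
  shows "phase_perm_congruent n h (\<lambda>i j. h (p i) (p j))"
  unfolding phase_perm_congruent_def using assms by (intro exI[of _ p] exI[of _ "\<lambda>_. 1"]) auto

lemma hermitian_hadamard_congruent:
  assumes "hermitian_hadamard n h" "phase_perm_congruent n h g"
  shows "hermitian_hadamard n g"
proof -
  from assms(2) obtain p d where p: "p permutes {..<n}" and d: "\<forall>i<n. cmod (d i) = 1"
    and g: "\<forall>i<n. \<forall>j<n. g i j = d i * h (p i) (p j) * cnj (d j)"
    unfolding phase_perm_congruent_def by auto
  have pl: "p i < n" if "i < n" for i using permutes_in_image[OF p, of i] that by simp
  have dd: "cnj (d k) * d k = 1" if "k < n" for k
    using d that by (metis complex_norm_square mult.commute of_real_1 power_one)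
  have "(\<Sum>k<n. g i k * g k j) = (if i = j then of_nat n else 0)" if i: "i < n" and j: "j < n" for i j
  proof -
    have "(\<Sum>k<n. g i k * g k j) = (\<Sum>k<n. d i * cnj (d j) * (h (p i) (p k) * h (p k) (p j)))"
    proof (rule sum.cong[OF refl])
      fix k assume "k \<in> {..<n}"
      then have "g i k * g k j = (cnj (d k) * d k) * (d i * cnj (d j) * (h (p i) (p k) * h (p k) (p j)))"
        using g i j by (simp add: algebra_simps)
      then show "g i k * g k j = d i * cnj (d j) * (h (p i) (p k) * h (p k) (p j))"
        using dd \<open>k \<in> {..<n}\<close> by simp
    qed
    also have "\<dots> = d i * cnj (d j) * (\<Sum>k<n. h (p i) (p k) * h (p k) (p j))"
      by (rule sum_distrib_left[symmetric])
    also have "(\<Sum>k<n. h (p i) (p k) * h (p k) (p j)) = (\<Sum>k<n. h (p i) k * h k (p j))"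
      by (rule sum.permute[OF p, of "\<lambda>k. h (p i) k * h k (p j)", unfolded o_def, symmetric])
    also have "\<dots> = (if p i = p j then of_nat n else 0)"
      using assms(1) pl[OF i] pl[OF j] by (rule hermitian_hadamardD)
    also have "(p i = p j) = (i = j)" using permutes_inj[OF p] by (auto dest: injD)
    finally show ?thesis using dd[OF i] by (auto simp: mult.commute)
  qed
  moreover have "g j i = cnj (g i j)" "cmod (g i j) = 1" if "i < n" "j < n" for i j
    using hermitian_hadamardD(1,2)[OF assms(1) pl[OF that(1)] pl[OF that(2)]] that g d
    by (simp_all add: norm_mult)
  ultimately show ?thesis unfolding hermitian_hadamard_def by blast
qed

lemma unitary_diagonal_mat:
  assumes "\<forall>i<n. cmod (d i) = 1"
  shows "unitary_diagonal n (mat n n (\<lambda>(i, j). if i = j then d i else 0))"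
proof -
  have dd: "d k * cnj (d k) = 1" if "k < n" for k
    using assms that by (metis complex_norm_square of_real_1 power_one)
  let ?D = "mat n n (\<lambda>(i, j). if i = j then d i else 0)"
  have "?D * mat_adjoint ?D = 1\<^sub>m n"
  proof (rule eq_matI)
    fix i j assume "i < dim_row (1\<^sub>m n :: complex mat)" "j < dim_col (1\<^sub>m n :: complex mat)"
    then have ij: "i < n" "j < n" by auto
    have "(?D * mat_adjoint ?D) $$ (i, j) = (\<Sum>k<n. ?D $$ (i, k) * mat_adjoint ?D $$ (k, j))"
      by (rule index_mult_mat_sum[of _ n n _ n]) (use ij in auto)
    also have "\<dots> = (\<Sum>k<n. if k = i then (if i = j then 1 else 0) else 0)"
      by (rule sum.cong) (use ij dd in \<open>auto simp: index_mat_adjoint\<close>)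
    finally show "(?D * mat_adjoint ?D) $$ (i, j) = 1\<^sub>m n $$ (i, j)" using ij by simp
  qed auto
  then show ?thesis unfolding unitary_diagonal_def by (auto simp: diagonal_mat_def)
qed

text \<open>Solving the congruence for \<open>H\<close>, with \<open>r\<close> the inverse of
  \<open>p\<close>, gives \<open>H $$ (i, j) = cnj (d (r i)) * g (r i) (r j) * d (r j)\<close>. The
  four factors are read off from this: multiplying by \<open>P\<close> on the left selects row
  \<open>r i\<close>, and by \<open>Q\<close> on the right column \<open>r j\<close>.\<close>

lemma hadamard_equivalent_congruent:
  assumes H: "H \<in> carrier_mat n n" and c: "phase_perm_congruent n (\<lambda>i j. H $$ (i, j)) g"
  shows "hadamard_equivalent n H (mat n n (\<lambda>(i, j). g i j))"
proof -
  from c obtain p d where p: "p permutes {..<n}" and d: "\<forall>i<n. cmod (d i) = 1"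
    and g: "\<forall>i<n. \<forall>j<n. g i j = d i * H $$ (p i, p j) * cnj (d j)"
    unfolding phase_perm_congruent_def by auto
  define r where "r = inv_into UNIV p"
  have r: "r permutes {..<n}" unfolding r_def using p by (rule permutes_inv)
  have rl: "r i < n" if "i < n" for i using permutes_in_image[OF r, of i] that by simp
  have pr: "p (r i) = i" "r (p i) = i" for i
    unfolding r_def using permutes_inverses[OF p] by auto
  have dd: "cnj (d k) * d k = 1" if "k < n" for k
    using d that by (metis complex_norm_square mult.commute of_real_1 power_one)
  define D1 where "D1 = mat n n (\<lambda>(i, j). if i = j then cnj (d (r i)) else 0)"
  define D2 where "D2 = mat n n (\<lambda>(i, j). if i = j then d (r i) else 0)"
  define P where "P = mat n n (\<lambda>(i, j). if i = p j then 1 else 0 :: complex)"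
  define Q where "Q = mat n n (\<lambda>(i, j). if i = r j then 1 else 0 :: complex)"
  define K where "K = mat n n (\<lambda>(i, j). g i j)"
  have car: "D1 \<in> carrier_mat n n" "D2 \<in> carrier_mat n n" "P \<in> carrier_mat n n"
    "Q \<in> carrier_mat n n" "K \<in> carrier_mat n n"
    unfolding D1_def D2_def P_def Q_def K_def by auto
  note car' = car mult_carrier_mat[of _ n n _ n]
  have "H = D1 * (P * (K * (Q * D2)))"
  proof (rule eq_matI)
    fix i j assume "i < dim_row (D1 * (P * (K * (Q * D2))))" "j < dim_col (D1 * (P * (K * (Q * D2))))"
    then have ij: "i < n" "j < n" using car by auto
    have 1: "(Q * D2) $$ (k, j) = (if k = r j then d (r j) else 0)" if "k < n" for k
    proof -
      have "(Q * D2) $$ (k, j) = (\<Sum>l<n. Q $$ (k, l) * D2 $$ (l, j))"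
        by (rule index_mult_mat_sum[of _ n n _ n]) (use ij that car' in auto)
      also have "\<dots> = (\<Sum>l<n. if l = j then Q $$ (k, j) * d (r j) else 0)"
        by (rule sum.cong) (use ij in \<open>auto simp: D2_def\<close>)
      finally show ?thesis using ij that by (simp add: Q_def)
    qed
    have 2: "(K * (Q * D2)) $$ (k, j) = g k (r j) * d (r j)" if "k < n" for k
    proof -
      have "(K * (Q * D2)) $$ (k, j) = (\<Sum>l<n. K $$ (k, l) * (Q * D2) $$ (l, j))"
        by (rule index_mult_mat_sum[of _ n n _ n]) (use ij that car' in auto)
      also have "\<dots> = (\<Sum>l<n. if l = r j then g k (r j) * d (r j) else 0)"
        by (rule sum.cong) (use ij that in \<open>auto simp: K_def 1 simp del: index_mult_mat\<close>)
      finally show ?thesis using ij that rl by simp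
    qed
    have 3: "(P * (K * (Q * D2))) $$ (k, j) = g (r k) (r j) * d (r j)" if "k < n" for k
    proof -
      have "(P * (K * (Q * D2))) $$ (k, j) = (\<Sum>l<n. P $$ (k, l) * (K * (Q * D2)) $$ (l, j))"
        by (rule index_mult_mat_sum[of _ n n _ n]) (use ij that car' in auto)
      also have "\<dots> = (\<Sum>l<n. if l = r k then g (r k) (r j) * d (r j) else 0)"
        by (rule sum.cong) (use ij that in \<open>auto simp: P_def 2 pr simp del: index_mult_mat\<close>)
      finally show ?thesis using ij that rl by simp
    qed
    have "(D1 * (P * (K * (Q * D2)))) $$ (i, j) = (\<Sum>l<n. D1 $$ (i, l) * (P * (K * (Q * D2))) $$ (l, j))"
      by (rule index_mult_mat_sum[of _ n n _ n]) (use ij car' in auto)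
    also have "\<dots> = (\<Sum>l<n. if l = i then cnj (d (r i)) * g (r i) (r j) * d (r j) else 0)"
      by (rule sum.cong) (use ij in \<open>auto simp: D1_def 3 simp del: index_mult_mat\<close>)
    also have "\<dots> = (cnj (d (r i)) * d (r i)) * H $$ (i, j) * (cnj (d (r j)) * d (r j))"
      using ij g rl by (simp add: pr)
    also have "\<dots> = H $$ (i, j)" using dd rl ij by simp
    finally show "H $$ (i, j) = (D1 * (P * (K * (Q * D2)))) $$ (i, j)" by simp
  qed (use H car in auto)
  then have "H = D1 * P * K * Q * D2"
    using car by (simp add: assoc_mult_mat[of _ n n _ n _ n])
  moreover have "unitary_diagonal n D1" "unitary_diagonal n D2"
    unfolding D1_def D2_def using d rl by (auto intro!: unitary_diagonal_mat)
  moreover have "permutation_matrix n P" "permutation_matrix n Q"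
    unfolding permutation_matrix_def P_def Q_def using p r by blast+
  ultimately show ?thesis unfolding hadamard_equivalent_def K_def by blast
qed

lemma complex_hadamard_mat:
  assumes "hermitian_hadamard n g"
  shows "complex_hadamard n (mat n n (\<lambda>(i, j). g i j))"
proof -
  let ?K = "mat n n (\<lambda>(i, j). g i j)"
  have "?K * mat_adjoint ?K = of_nat n \<cdot>\<^sub>m 1\<^sub>m n"
  proof (rule eq_matI)
    fix i j assume "i < dim_row (of_nat n \<cdot>\<^sub>m 1\<^sub>m n :: complex mat)"
      "j < dim_col (of_nat n \<cdot>\<^sub>m 1\<^sub>m n :: complex mat)"
    then have ij: "i < n" "j < n" by auto
    have "(?K * mat_adjoint ?K) $$ (i, j) = (\<Sum>k<n. ?K $$ (i, k) * mat_adjoint ?K $$ (k, j))"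
      by (rule index_mult_mat_sum[of _ n n _ n]) (use ij in auto)
    also have "\<dots> = (\<Sum>k<n. g i k * g k j)"
      by (rule sum.cong) (use ij hermitian_hadamardD(1)[OF assms, symmetric] in \<open>auto simp: index_mat_adjoint\<close>)
    finally show "(?K * mat_adjoint ?K) $$ (i, j) = (of_nat n \<cdot>\<^sub>m 1\<^sub>m n) $$ (i, j)"
      using ij hermitian_hadamardD(3)[OF assms ij] by simp
  qed auto
  then show ?thesis using hermitian_hadamardD(2)[OF assms] unfolding complex_hadamard_def by auto
qed

lemma hermitian_hadamard_index:
  assumes "complex_hadamard n H" "mat_adjoint H = H"
  shows "hermitian_hadamard n (\<lambda>i j. H $$ (i, j))"
  unfolding hermitian_hadamard_def
proof (intro allI impI)
  fix i j assume ij: "i < n" "j < n"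
  have H: "H \<in> carrier_mat n n" and HH: "H * H = of_nat n \<cdot>\<^sub>m 1\<^sub>m n" and "cmod (H $$ (i, j)) = 1"
    using assms ij unfolding complex_hadamard_def by auto
  moreover have "H $$ (j, i) = cnj (H $$ (i, j))"
    using index_mat_adjoint[of j H i] H ij assms(2) by auto
  moreover have "(\<Sum>k<n. H $$ (i, k) * H $$ (k, j)) = (if i = j then of_nat n else 0)"
    using index_mult_mat_sum[OF H H ij, symmetric] ij unfolding HH by simp
  ultimately show "H $$ (j, i) = cnj (H $$ (i, j)) \<and> cmod (H $$ (i, j)) = 1 \<and>
     (\<Sum>k<n. H $$ (i, k) * H $$ (k, j)) = (if i = j then of_nat n else 0)" by blast
qed

section \<open>Unimodular numbers, signs of the diagonal and cyclic triple products\<close>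

lemma cnj_unimodular:
  assumes "cmod z = 1"
  shows "z * cnj z = 1"
  using assms by (metis complex_norm_square of_real_1 power_one)

lemma real_unimodular:
  assumes "cmod z = 1" "z = cnj z"
  shows "z = 1 \<or> z = -1"
  using cnj_unimodular[OF assms(1)] assms(2)[symmetric] by (simp add: square_eq_1_iff)

lemma sum_lessThan_6: "(\<Sum>k<6. f k) = f 0 + f 1 + f 2 + f 3 + f 4 + f (5::nat)"
  by (simp add: eval_nat_numeral)

lemma less_3_iff: "(i::nat) < 3 \<longleftrightarrow> i = 0 \<or> i = 1 \<or> i = 2"
  by auto

lemma all_less_3: "(\<forall>i<3. P i) \<longleftrightarrow> P 0 \<and> P 1 \<and> P (2::nat)"
  by (auto simp: less_3_iff)

text \<open>The diagonal entries are 1 or -1, so the trace is an integer \<open>T\<close> of modulus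
  at most 6. Instead of the irrationality of the root of 6, the finitely many solutions of
  \<open>T\<^sup>2 = 6 * k\<^sup>2\<close> in this range are checked.\<close>

lemma trace_hermitian_hadamard_6:
  assumes "complex_hadamard 6 H" "mat_adjoint H = H"
  shows "(\<Sum>i<6. H $$ (i, i)) = 0"
proof -
  define s where "s = complex_of_real (sqrt 6)"
  have s2: "s\<^sup>2 = 6" unfolding s_def by (simp flip: of_real_power)
  have "H \<in> carrier_mat 6 6" "H * H = s\<^sup>2 \<cdot>\<^sub>m 1\<^sub>m 6"
    using assms unfolding complex_hadamard_def s2 by auto
  then obtain k :: int where k: "(\<Sum>i<6. H $$ (i, i)) = of_int k * s"
    using sum_diag_sqrt_scalar by blast
  have "\<exists>t::int. H $$ (i, i) = of_int t \<and> \<bar>t\<bar> \<le> 1" if "i < 6" for i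
    using real_unimodular[OF hermitian_hadamardD(2,1)[OF hermitian_hadamard_index[OF assms] that that]]
    by (auto intro: exI[of _ 1] exI[of _ "-1"])
  then obtain t :: "nat \<Rightarrow> int" where t: "\<And>i. i < 6 \<Longrightarrow> H $$ (i, i) = of_int (t i) \<and> \<bar>t i\<bar> \<le> 1"
    by metis
  define T where "T = (\<Sum>i<6. t i)"
  have T: "(\<Sum>i<6. H $$ (i, i)) = of_int T" unfolding T_def by (simp add: t)
  have "(of_int (T\<^sup>2) :: complex) = of_int (6 * k\<^sup>2)"
    using k unfolding T by (simp add: power_mult_distrib s2)
  then have eq: "T\<^sup>2 = 6 * k\<^sup>2" by (simp only: of_int_eq_iff)
  have "\<bar>T\<bar> \<le> (\<Sum>i<6. \<bar>t i\<bar>)" unfolding T_def by (rule sum_abs)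
  also have "\<dots> \<le> (\<Sum>i<(6::nat). 1)" by (rule sum_mono) (simp add: t)
  finally have "\<bar>T\<bar> \<le> 6" by simp
  then have "T = -6 \<or> T = -5 \<or> T = -4 \<or> T = -3 \<or> T = -2 \<or> T = -1 \<or> T = 0 \<or>
      T = 1 \<or> T = 2 \<or> T = 3 \<or> T = 4 \<or> T = 5 \<or> T = 6" by arith
  moreover have "\<bar>k\<bar> \<le> 2"
  proof (rule ccontr)
    assume "\<not> \<bar>k\<bar> \<le> 2"
    \<comment> \<open>A value of \<open>k\<close> of modulus 3 or more would make the right side at
      least 54, while the left side is at most 36.\<close>
    then have "3\<^sup>2 \<le> \<bar>k\<bar>\<^sup>2" by (intro power_mono) auto
    moreover have "\<bar>T\<bar>\<^sup>2 \<le> 6\<^sup>2" using \<open>\<bar>T\<bar> \<le> 6\<close> by (intro power_mono) auto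
    ultimately show False using eq by simp
  qed
  then have "k = -2 \<or> k = -1 \<or> k = 0 \<or> k = 1 \<or> k = 2" by arith
  ultimately have "T = 0" using eq by (elim disjE) simp_all
  then show ?thesis unfolding T by simp
qed

text \<open>The trace is the number of entries 1 minus the number of entries -1, so each sign occurs
  three times. Bijections from the two halves of the indices onto the two sign classes are glued to
  a permutation.\<close>

lemma diagonal_signs:
  assumes h: "hermitian_hadamard 6 h" and tr: "(\<Sum>i<6. h i i) = 0"
  shows "\<exists>g. phase_perm_congruent 6 h g \<and> (\<forall>i<3. g i i = 1 \<and> g (3 + i) (3 + i) = -1)"
proof -
  have pm: "h i i = 1 \<or> h i i = -1" if "i < 6" for i
    using real_unimodular[OF hermitian_hadamardD(2,1)[OF h that that]] .
  define S where "S = {i. i < 6 \<and> h i i = 1}"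
  define S' where "S' = {i. i < 6 \<and> h i i = -1}"
  have fin: "finite S" "finite S'" and dj: "S \<inter> S' = {}" and un: "S \<union> S' = {..<6}"
    unfolding S_def S'_def using pm by auto
  have "(\<Sum>i<6. h i i) = (\<Sum>i\<in>S. h i i) + (\<Sum>i\<in>S'. h i i)"
    using sum.union_disjoint[OF fin dj, of "\<lambda>i. h i i"] unfolding un .
  also have "\<dots> = of_nat (card S) - of_nat (card S')" unfolding S_def S'_def by simp
  finally have "card S = card S'" using tr by simp
  moreover have "card S + card S' = 6" using card_Un_disjoint[OF fin dj] unfolding un by simp
  ultimately have c: "card {..<3::nat} = card S" "card {3..<6::nat} = card S'" by auto
  obtain f where f: "bij_betw f {..<3::nat} S" using finite_same_card_bij[OF _ fin(1) c(1)] by blast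
  obtain f' where f': "bij_betw f' {3..<6::nat} S'" using finite_same_card_bij[OF _ fin(2) c(2)] by auto
  \<comment> \<open>The identity outside the six indices is what \<open>permutes\<close>
    demands.\<close>
  define p where "p i = (if i < 3 then f i else if i < 6 then f' i else i)" for i
  have 1: "bij_betw p {..<3} S" using f by (rule bij_betw_cong[THEN iffD1, rotated]) (simp add: p_def)
  have 2: "bij_betw p {3..<6} S'" using f' by (rule bij_betw_cong[THEN iffD1, rotated]) (simp add: p_def)
  have "bij_betw p ({..<3} \<union> {3..<6}) (S \<union> S')" using 1 2 dj by (rule bij_betw_combine)
  moreover have "{..<3} \<union> {3..<6} = {..<6::nat}" by auto
  ultimately have p: "p permutes {..<6}" unfolding un by (intro bij_imp_permutes) (auto simp: p_def)
  have "h (p i) (p i) = 1" "h (p (3 + i)) (p (3 + i)) = -1" if "i < 3" for i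
    using bij_betwE[OF 1, rule_format, of i] bij_betwE[OF 2, rule_format, of "3 + i"] that
    unfolding S_def S'_def by auto
  then show ?thesis using phase_perm_congruent_permute[OF p, of h] by blast
qed

text \<open>With \<open>L\<close>, \<open>U\<close> the two halves of the indices, let \<open>S P Q R\<close> be the sum of \<open>g\<^sub>i\<^sub>j g\<^sub>j\<^sub>k g\<^sub>k\<^sub>i\<close> over
  \<open>i \<in> P\<close>, \<open>j \<in> Q\<close>, \<open>k \<in> R\<close>. It is invariant under cyclic shifts of \<open>P, Q, R\<close>, and \<open>g\<^sup>2 = 6\<close> evaluates
  \<open>S P Q L + S P Q U\<close>; together these give \<open>S L L L + S U U U = 0\<close>.\<close>

lemma Re_triple_products_opposite:
  fixes g :: "nat \<Rightarrow> nat \<Rightarrow> complex"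
  assumes g: "hermitian_hadamard 6 g"
    and dg: "\<forall>i<3. g i i = 1 \<and> g (3 + i) (3 + i) = -1"
  shows "Re (g 0 1 * g 1 2 * g 2 0) = - Re (g 3 4 * g 4 5 * g 5 3)"
proof -
  define S where "S P Q R = (\<Sum>i\<in>P. \<Sum>j\<in>Q. \<Sum>k\<in>R. g i j * g j k * g k i)" for P Q R
  define L U where "L = {..<3::nat}" and "U = {3..<6::nat}"
  have LU: "finite L" "finite U" "L \<inter> U = {}" "{..<6} = L \<union> U" unfolding L_def U_def by auto
  have lu: "i < 6" if "i \<in> L \<union> U" for i using that unfolding L_def U_def by auto
  have LU': "L = {0, 1, 2}" "U = {3, 4, 5}" unfolding L_def U_def by auto
  have cyc: "S P Q R = S Q R P" for P Q R
  proof -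
    have "S P Q R = (\<Sum>j\<in>Q. \<Sum>i\<in>P. \<Sum>k\<in>R. g i j * g j k * g k i)"
      unfolding S_def by (rule sum.swap)
    also have "\<dots> = (\<Sum>j\<in>Q. \<Sum>k\<in>R. \<Sum>i\<in>P. g i j * g j k * g k i)"
      by (intro sum.cong refl sum.swap)
    also have "\<dots> = S Q R P" unfolding S_def by (intro sum.cong refl) (simp add: mult.commute mult.left_commute)
    finally show ?thesis .
  qed
  have ex: "S P Q L + S P Q U = (\<Sum>i\<in>P. \<Sum>j\<in>Q. g i j * (if j = i then 6 else 0))"
    if "P \<subseteq> L \<union> U" "Q \<subseteq> L \<union> U" for P Q
  proof -
    have "S P Q L + S P Q U = (\<Sum>i\<in>P. \<Sum>j\<in>Q. \<Sum>k<6. g i j * g j k * g k i)"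
      unfolding S_def LU(4) by (simp add: sum.union_disjoint[OF LU(1,2,3)] sum.distrib)
    also have "\<dots> = (\<Sum>i\<in>P. \<Sum>j\<in>Q. g i j * (if j = i then 6 else 0))"
    proof (intro sum.cong refl)
      fix i j assume "i \<in> P" "j \<in> Q"
      with that have ij: "i < 6" "j < 6" using lu by blast+
      have "(\<Sum>k<6. g i j * g j k * g k i) = g i j * (\<Sum>k<6. g j k * g k i)"
        unfolding sum_distrib_left by (simp add: mult.assoc)
      then show "(\<Sum>k<6. g i j * g j k * g k i) = g i j * (if j = i then 6 else 0)"
        using hermitian_hadamardD(3)[OF g ij(2,1)] by simp
    qed
    finally show ?thesis .
  qed
  \<comment> \<open>Only pairs \<open>i = j\<close> contribute, each 6 times a diagonal entry, and
    each half has three of them.\<close>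
  have e: "S L L L + S L L U = 18" "S L U L + S L U U = 0" "S U U L + S U U U = -18"
    using dg by (subst ex; simp add: LU' all_less_3)+
  \<comment> \<open>By cyclic invariance \<open>S L L U\<close> cancels against
    \<open>S L U L\<close>, and \<open>S L U U\<close> against \<open>S U U L\<close>.\<close>
  have "S L L L + S U U U = (S L L L + S L L U) - (S L U L + S L U U) + (S U U L + S U U U)"
    unfolding cyc[of L L U] cyc[of U U L] cyc[of U L U] by simp
  then have z: "S L L L + S U U U = 0" unfolding e by simp
  note D = hermitian_hadamardD(1,2)[OF g]
  \<comment> \<open>Among the 27 terms, the 3 with equal indices give \<open>e * e * e = e\<close>,
    and the 18 with exactly two equal indices give \<open>e\<close> times a squared modulus. The
    remaining 6 are three copies of the cyclic product and three of its conjugate.\<close>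
  have tri: "(\<Sum>i\<in>{a,b,c}. \<Sum>j\<in>{a,b,c}. \<Sum>k\<in>{a,b,c}. g i j * g j k * g k i)
      = 21 * e + 6 * of_real (Re (g a b * g b c * g c a))"
    if ne: "a \<noteq> b" "a \<noteq> c" "b \<noteq> c" and l: "a < 6" "b < 6" "c < 6"
      and e: "g a a = e" "g b b = e" "g c c = e" "e * e = 1" for a b c e
  proof -
    note cc = D(1)[OF l(1,2)] D(1)[OF l(1,3)] D(1)[OF l(2,3)]
    have u: "g a b * cnj (g a b) = 1" "g a c * cnj (g a c) = 1" "g b c * cnj (g b c) = 1"
      using D(2) l by (auto intro: cnj_unimodular)
    have r: "2 * complex_of_real (Re (g a b * g b c * g c a)) =
        g a b * g b c * cnj (g a c) + cnj (g a b) * cnj (g b c) * g a c"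
      unfolding cc by (subst complex_add_cnj[symmetric, simplified]) simp
    have "21 * e + 6 * of_real (Re (g a b * g b c * g c a)) =
        21 * e + 3 * (2 * complex_of_real (Re (g a b * g b c * g c a)))"
      by simp
    also have "\<dots> = (\<Sum>i\<in>{a,b,c}. \<Sum>j\<in>{a,b,c}. \<Sum>k\<in>{a,b,c}. g i j * g j k * g k i)"
      unfolding r using ne by (simp add: e(1-3) cc) (simp add: u e(4))
    finally show ?thesis by simp
  qed
  have "S L L L = 21 * 1 + 6 * of_real (Re (g 0 1 * g 1 2 * g 2 0))"
    "S U U U = 21 * (-1) + 6 * of_real (Re (g 3 4 * g 4 5 * g 5 3))"
    unfolding S_def LU' using dg by (auto simp only: intro!: tri) (auto simp: all_less_3)
  with z have "complex_of_real (6 * (Re (g 0 1 * g 1 2 * g 2 0) + Re (g 3 4 * g 4 5 * g 5 3))) = of_real 0"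
    by (simp del: times_complex.sel)
  then have "6 * (Re (g 0 1 * g 1 2 * g 2 0) + Re (g 3 4 * g 4 5 * g 5 3)) = 0"
    by (simp only: of_real_eq_iff)
  then show ?thesis
    unfolding eq_neg_iff_add_eq_0 by (simp del: times_complex.sel)
qed

lemma cnj_eq_or_eq_of_Re_eq:
  assumes "cmod z = 1" "cmod w = 1" "Re z = Re w"
  shows "z = w \<or> z = cnj w"
proof -
  have "(Re z)\<^sup>2 + (Im z)\<^sup>2 = 1" "(Re w)\<^sup>2 + (Im w)\<^sup>2 = 1"
    using assms(1,2) cmod_power2[of z] cmod_power2[of w] by auto
  then have "(Im z)\<^sup>2 = (Im w)\<^sup>2" using assms(3) by simp
  then show ?thesis using assms(3) by (auto simp: power2_eq_iff complex_eq_iff)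
qed

text \<open>Choosing real roots of 1 and -1 later reduces the case \<open>u ^ 6 = 1\<close> to
  \<open>u = 1\<close> and \<open>u = -1\<close>.\<close>

lemma unimodular_cube_root:
  assumes "cmod z = 1"
  shows "\<exists>u. cmod u = 1 \<and> u ^ 3 = z \<and> (z = 1 \<longrightarrow> u = 1) \<and> (z = -1 \<longrightarrow> u = -1)"
proof -
  consider "z = 1" | "z = -1" | "z \<noteq> 1" "z \<noteq> -1" by blast
  then show ?thesis
  proof cases
    case 3
    have "z \<noteq> 0" using assms by auto
    then have "cis (Arg z / 3) ^ 3 = z"
      using assms by (subst DeMoivre) (simp add: cis_Arg sgn_eq)
    then show ?thesis using 3 by (intro exI[of _ "cis (Arg z / 3)"]) simp
  qed (auto intro: exI[of _ 1] exI[of _ "-1"])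
qed

section \<open>Circulant normal form and the generic case\<close>

text \<open>The remaining entries of the diagonal blocks are conjugates of these once the matrix is
  Hermitian.\<close>

definition circulant_diagonal_blocks :: "complex \<Rightarrow> (nat \<Rightarrow> nat \<Rightarrow> complex) \<Rightarrow> bool" where
  "circulant_diagonal_blocks u g \<longleftrightarrow> (\<forall>i<3. g i i = 1 \<and> g (3 + i) (3 + i) = -1 \<and>
     g i ((i + 1) mod 3) = u \<and> g (3 + i) (3 + (i + 1) mod 3) = - u)"

text \<open>Each block is required to be invariant under a simultaneous cyclic shift of its rows and
  columns; \<open>r\<close> and \<open>c\<close> are the offsets of the block.\<close>

definition block_circulant :: "(nat \<Rightarrow> nat \<Rightarrow> complex) \<Rightarrow> bool" where
  "block_circulant g \<longleftrightarrow> (\<forall>r\<in>{0, 3}. \<forall>c\<in>{0, 3}. \<forall>i<3. \<forall>j<3.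
     g (r + (i + 1) mod 3) (c + (j + 1) mod 3) = g (r + i) (c + j))"

lemma shift_mod_3:
  "(0 + 1) mod 3 = (1::nat)" "(1 + 1) mod 3 = (2::nat)" "(2 + 1) mod 3 = (0::nat)"
  "(0 + 2) mod 3 = (2::nat)" "(1 + 2) mod 3 = (0::nat)" "(2 + 2) mod 3 = (1::nat)"
  "3 + 0 = (3::nat)" "3 + 1 = (4::nat)" "3 + 2 = (5::nat)"
  by simp_all

text \<open>Phases leave cyclic products unchanged. Once two of the three cyclic entries of the
  upper block equal \<open>u\<close>, the third does too, as the product is \<open>u ^ 3\<close>.
  The opposite product allows the same with \<open>- u\<close> in the lower block.\<close>

lemma rescale_to_circulant:
  assumes g: "hermitian_hadamard 6 g"
    and dg: "\<forall>i<3. g i i = 1 \<and> g (3 + i) (3 + i) = -1"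
    and opp: "g 3 4 * g 4 5 * g 5 3 = - (g 0 1 * g 1 2 * g 2 0)"
  shows "\<exists>u f. phase_perm_congruent 6 g f \<and> circulant_diagonal_blocks u f \<and> cmod u = 1 \<and>
    (u ^ 3 = 1 \<longrightarrow> u = 1) \<and> (u ^ 3 = -1 \<longrightarrow> u = -1)"
proof -
  have n: "cmod (g i j) = 1" if "i < 6" "j < 6" for i j using hermitian_hadamardD(2)[OF g that] .
  have "cmod (g 0 1 * g 1 2 * g 2 0) = 1" by (simp add: norm_mult n)
  from unimodular_cube_root[OF this] obtain u where u: "cmod u = 1" and u3: "u ^ 3 = g 0 1 * g 1 2 * g 2 0"
    and nu: "u ^ 3 = 1 \<longrightarrow> u = 1" "u ^ 3 = -1 \<longrightarrow> u = -1" by metis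
  define U where "U = cnj u"
  have uU: "u * U = 1" unfolding U_def using u by (rule cnj_unimodular)
  have cU: "cnj U = u" unfolding U_def by simp
  \<comment> \<open>Starting from \<open>d 0 = 1\<close> and \<open>d 3 = 1\<close>, these values
    solve \<open>f 0 1 = u\<close>, \<open>f 1 2 = u\<close>, \<open>f 3 4 = - u\<close> and
    \<open>f 4 5 = - u\<close> in turn.\<close>
  define d where "d = (\<lambda>i::nat. if i = 1 then g 0 1 * U else if i = 2 then g 0 1 * g 1 2 * U\<^sup>2
    else if i = 4 then - g 3 4 * U else if i = 5 then g 3 4 * g 4 5 * U\<^sup>2 else 1)"
  define f where "f i j = d i * g i j * cnj (d j)" for i j
  have "cmod (d i) = 1" for i
    unfolding d_def U_def using u by (simp add: norm_mult norm_power n)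
  then have "phase_perm_congruent 6 g f"
    unfolding phase_perm_congruent_def f_def by (intro exI[of _ id] exI[of _ d]) (auto simp: permutes_id)
  moreover have "circulant_diagonal_blocks u f"
  proof -
    have gg: "g i j * cnj (g i j) = 1" if "i < 6" "j < 6" for i j using n[OF that] by (rule cnj_unimodular)
    have d1: "d i * cnj (d i) = 1" for i using \<open>cmod (d i) = 1\<close> by (rule cnj_unimodular)
    have "f i i = g i i" for i unfolding f_def using d1[of i] by (simp add: mult.commute mult.left_commute)
    moreover have "f 0 1 = (g 0 1 * cnj (g 0 1)) * u"
      "f 1 2 = (g 0 1 * cnj (g 0 1)) * (g 1 2 * cnj (g 1 2)) * (u * U) * u"
      "f 2 0 = (g 0 1 * g 1 2 * g 2 0) * U\<^sup>2"
      "f 3 4 = - (g 3 4 * cnj (g 3 4)) * u"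
      "f 4 5 = - (g 3 4 * cnj (g 3 4)) * (g 4 5 * cnj (g 4 5)) * (u * U) * u"
      "f 5 3 = (g 3 4 * g 4 5 * g 5 3) * U\<^sup>2"
      unfolding f_def d_def by (simp_all add: cU power2_eq_square)
    moreover have "(g 0 1 * g 1 2 * g 2 0) * U\<^sup>2 = u"
    proof -
      have "u ^ 3 * U\<^sup>2 = (u * U)\<^sup>2 * u" by (simp add: power2_eq_square power3_eq_cube)
      then show ?thesis unfolding u3 uU by simp
    qed
    ultimately have "f i i = g i i" "f 0 1 = u" "f 1 2 = u" "f 2 0 = u" "f 3 4 = - u" "f 4 5 = - u" "f 5 3 = - u" for i
      unfolding opp by (simp_all add: gg uU)
    then show ?thesis
      using dg unfolding circulant_diagonal_blocks_def all_less_3 shift_mod_3 by metis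
  qed
  ultimately show ?thesis using u nu by blast
qed

text \<open>The commutation relation says that the defect \<open>\<delta>\<close> from being circulant satisfies
  \<open>\<delta> i j = u\<^sup>2 * \<delta> (i + 1) (j + 2)\<close> modulo 3; three iterations return to \<open>(i, j)\<close>.\<close>

lemma circulant_of_commute_circulant:
  fixes b :: "nat \<Rightarrow> nat \<Rightarrow> complex"
  assumes uU: "u * U = 1" and u6: "u ^ 6 \<noteq> 1"
    and eq: "\<forall>i<3. \<forall>j<3. u * b ((i + 1) mod 3) j + U * b ((i + 2) mod 3) j =
      U * b i ((j + 1) mod 3) + u * b i ((j + 2) mod 3)"
  shows "\<forall>i<3. \<forall>j<3. b ((i + 1) mod 3) ((j + 1) mod 3) = b i j"
proof -
  define \<delta> where "\<delta> r c = b ((r + 1) mod 3) ((c + 1) mod 3) - b r c" for r c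
  have shift: "\<delta> i j = u\<^sup>2 * \<delta> ((i + 1) mod 3) ((j + 2) mod 3)" if "i < 3" "j < 3" for i j
  proof -
    \<comment> \<open>Collecting the terms of the relation at row \<open>i + 1\<close> and column
      \<open>j\<close> by their coefficients \<open>u\<close> and \<open>U\<close> leaves one defect
      on each side.\<close>
    have "u * \<delta> ((i + 1) mod 3) ((j + 2) mod 3) = U * \<delta> i j"
      using eq[rule_format, of "(i + 1) mod 3" j] that unfolding less_3_iff \<delta>_def
      by (elim disjE) (simp_all add: numeral_2_eq_2 algebra_simps)
    then have "u * (u * \<delta> ((i + 1) mod 3) ((j + 2) mod 3)) = (u * U) * \<delta> i j" by (simp add: mult.assoc)
    then show ?thesis unfolding uU by (simp add: power2_eq_square mult.assoc)
  qed
  have "\<delta> i j = u ^ 6 * \<delta> i j" if ij: "i < 3" "j < 3" for i j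
  proof -
    have "\<delta> i j = u\<^sup>2 * (u\<^sup>2 * (u\<^sup>2 * \<delta> ((((i + 1) mod 3 + 1) mod 3 + 1) mod 3) ((((j + 2) mod 3 + 2) mod 3 + 2) mod 3)))"
      using ij by (subst shift; simp?)+
    also have "(((i + 1) mod 3 + 1) mod 3 + 1) mod 3 = i" using ij by (auto simp: less_3_iff)
    also have "(((j + 2) mod 3 + 2) mod 3 + 2) mod 3 = j" using ij by (auto simp: less_3_iff)
    finally show ?thesis by (simp add: mult.assoc[symmetric] power2_eq_square eval_nat_numeral)
  qed
  then have "\<delta> i j = 0" if "i < 3" "j < 3" for i j using that u6 by (metis mult_cancel_right1)
  then show ?thesis unfolding \<delta>_def by simp
qed

lemma circulant_diagonal_blocks_entries:
  assumes g: "hermitian_hadamard 6 g" and c: "circulant_diagonal_blocks u g"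
  shows "g 0 0 = 1" "g 1 1 = 1" "g 2 2 = 1" "g 3 3 = -1" "g 4 4 = -1" "g 5 5 = -1"
    "g 0 1 = u" "g 1 2 = u" "g 2 0 = u" "g 3 4 = -u" "g 4 5 = -u" "g 5 3 = -u"
    "g 1 0 = cnj u" "g 2 1 = cnj u" "g 0 2 = cnj u"
    "g 4 3 = - cnj u" "g 5 4 = - cnj u" "g 3 5 = - cnj u"
proof -
  show r: "g 0 0 = 1" "g 1 1 = 1" "g 2 2 = 1" "g 3 3 = -1" "g 4 4 = -1" "g 5 5 = -1"
    "g 0 1 = u" "g 1 2 = u" "g 2 0 = u" "g 3 4 = -u" "g 4 5 = -u" "g 5 3 = -u"
    using c unfolding circulant_diagonal_blocks_def all_less_3 shift_mod_3 by blast+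
  note H = hermitian_hadamardD(1)[OF g]
  show "g 1 0 = cnj u" "g 2 1 = cnj u" "g 0 2 = cnj u"
    "g 4 3 = - cnj u" "g 5 4 = - cnj u" "g 3 5 = - cnj u"
    using H[of 0 1] H[of 1 2] H[of 2 0] H[of 3 4] H[of 4 5] H[of 5 3] unfolding r by simp_all
qed

text \<open>The upper right block of the square of \<open>g\<close> is \<open>A B + B C = 0\<close>,
  which for \<open>C = - A\<close> says that \<open>A\<close> and \<open>B\<close> commute. The
  contributions of the diagonals of \<open>A\<close> and \<open>C\<close> cancel.\<close>

lemma commute_circulant_diagonal_blocks:
  assumes g: "hermitian_hadamard 6 g" and c: "circulant_diagonal_blocks u g"
  shows "\<forall>i<3. \<forall>j<3. u * g ((i + 1) mod 3) (3 + j) + cnj u * g ((i + 2) mod 3) (3 + j) =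
      cnj u * g i (3 + (j + 1) mod 3) + u * g i (3 + (j + 2) mod 3)"
proof -
  have R: "(\<Sum>k<6. g i k * g k j) = 0" if "i < 6" "j < 6" "i \<noteq> j" for i j
    using hermitian_hadamardD(3)[OF g that(1,2)] that(3) by simp
  note r = circulant_diagonal_blocks_entries[OF assms]
  have "u * g 1 3 + cnj u * g 2 3 = cnj u * g 0 4 + u * g 0 5"
    using R[of 0 3] unfolding sum_lessThan_6 r by (simp, simp add: algebra_simps)
  moreover have "u * g 1 4 + cnj u * g 2 4 = cnj u * g 0 5 + u * g 0 3"
    using R[of 0 4] unfolding sum_lessThan_6 r by (simp, simp add: algebra_simps)
  moreover have "u * g 1 5 + cnj u * g 2 5 = cnj u * g 0 3 + u * g 0 4"
    using R[of 0 5] unfolding sum_lessThan_6 r by (simp, simp add: algebra_simps)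
  moreover have "u * g 2 3 + cnj u * g 0 3 = cnj u * g 1 4 + u * g 1 5"
    using R[of 1 3] unfolding sum_lessThan_6 r by (simp, simp add: algebra_simps)
  moreover have "u * g 2 4 + cnj u * g 0 4 = cnj u * g 1 5 + u * g 1 3"
    using R[of 1 4] unfolding sum_lessThan_6 r by (simp, simp add: algebra_simps)
  moreover have "u * g 2 5 + cnj u * g 0 5 = cnj u * g 1 3 + u * g 1 4"
    using R[of 1 5] unfolding sum_lessThan_6 r by (simp, simp add: algebra_simps)
  moreover have "u * g 0 3 + cnj u * g 1 3 = cnj u * g 2 4 + u * g 2 5"
    using R[of 2 3] unfolding sum_lessThan_6 r by (simp, simp add: algebra_simps)
  moreover have "u * g 0 4 + cnj u * g 1 4 = cnj u * g 2 5 + u * g 2 3"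
    using R[of 2 4] unfolding sum_lessThan_6 r by (simp, simp add: algebra_simps)
  moreover have "u * g 0 5 + cnj u * g 1 5 = cnj u * g 2 3 + u * g 2 4"
    using R[of 2 5] unfolding sum_lessThan_6 r by (simp, simp add: algebra_simps)
  ultimately show ?thesis unfolding all_less_3 shift_mod_3 by blast
qed

text \<open>Only the upper right block needs checking: the lower left one is its adjoint, and the
  diagonal blocks are circulant by their shape.\<close>

lemma block_circulantI:
  assumes g: "hermitian_hadamard 6 g" and c: "circulant_diagonal_blocks u g"
    and b: "\<forall>i<3. \<forall>j<3. g ((i + 1) mod 3) (3 + (j + 1) mod 3) = g i (3 + j)"
  shows "block_circulant g"
proof -
  have lower: "g (3 + (i + 1) mod 3) ((j + 1) mod 3) = g (3 + i) j" if "i < 3" "j < 3" for i j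
  proof -
    have m: "(i + 1) mod 3 < 3" "(j + 1) mod 3 < 3" by simp_all
    have "g (3 + (i + 1) mod 3) ((j + 1) mod 3) = cnj (g ((j + 1) mod 3) (3 + (i + 1) mod 3))"
      by (rule hermitian_hadamardD[OF g]) (use m in linarith)+
    also have "\<dots> = cnj (g j (3 + i))" using b that by simp
    also have "\<dots> = g (3 + i) j" by (rule hermitian_hadamardD[OF g, symmetric]) (use that in linarith)+
    finally show ?thesis .
  qed
  have diag: "g (r + (i + 1) mod 3) (r + (j + 1) mod 3) = g (r + i) (r + j)"
    if "r \<in> {0, 3}" "i < 3" "j < 3" for r i j
    using that circulant_diagonal_blocks_entries[OF g c] unfolding less_3_iff insert_iff empty_iff
    by (elim disjE) (simp_all add: numeral_2_eq_2)
  show ?thesis using b lower diag[of 0] diag[of 3] unfolding block_circulant_def by simp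
qed

lemma two_circulant_mat:
  assumes "block_circulant g"
  shows "two_circulant (mat 6 6 (\<lambda>(i, j). g i j))"
proof -
  define B where "B r c = mat 3 3 (\<lambda>(i, j). g (r + i) (c + j))" for r c
  have circ: "circulant3 (B r c)" if "r \<in> {0, 3}" "c \<in> {0, 3}" for r c
  proof -
    have e: "\<forall>i<3. \<forall>j<3. g (r + (i + 1) mod 3) (c + (j + 1) mod 3) = g (r + i) (c + j)"
      using assms that unfolding block_circulant_def by blast
    have e': "g (Suc r) (Suc c) = g r c" "g (Suc (Suc r)) (Suc (Suc c)) = g r c"
      "g (Suc r) (Suc (Suc c)) = g r (Suc c)" "g (Suc (Suc r)) c = g r (Suc c)"
      "g (Suc r) c = g r (Suc (Suc c))" "g (Suc (Suc r)) (Suc c) = g r (Suc (Suc c))"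
      using e[rule_format, of 0 0] e[rule_format, of 1 1] e[rule_format, of 0 1]
        e[rule_format, of 1 2] e[rule_format, of 0 2] e[rule_format, of 1 0]
      by (simp_all add: numeral_2_eq_2)
    have "B r c = mat_of_rows_list 3 [[g r c, g r (c + 1), g r (c + 2)],
      [g r (c + 2), g r c, g r (c + 1)], [g r (c + 1), g r (c + 2), g r c]]"
    proof (rule eq_matI, goal_cases)
      case (1 i j)
      then have "i = 0 \<or> i = 1 \<or> i = 2" "j = 0 \<or> j = 1 \<or> j = 2"
        by (auto simp: mat_of_rows_list_def)
      then show ?case
        by (elim disjE) (simp_all add: B_def mat_of_rows_list_def e' numeral_2_eq_2)
    qed (simp_all add: B_def mat_of_rows_list_def)
    then show ?thesis unfolding circulant3_def by blast
  qed
  have "mat 6 6 (\<lambda>(i, j). g i j) = four_block_mat (B 0 0) (B 0 3) (B 3 0) (B 3 3)"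
    by (rule eq_matI) (auto simp: B_def)
  then show ?thesis unfolding two_circulant_def using circ by blast
qed

section \<open>The degenerate cases \<open>u = 1\<close> and \<open>u = -1\<close>\<close>

text \<open>The upper left block of the square of \<open>g\<close>, solved for
  \<open>B B* = 6 - A A\<close>.\<close>

lemma gram_upper_right:
  assumes g: "hermitian_hadamard 6 g" and "i < 3" "j < 3"
  shows "g i 3 * cnj (g j 3) + g i 4 * cnj (g j 4) + g i 5 * cnj (g j 5) =
    (if i = j then 6 else 0) - (g i 0 * g 0 j + g i 1 * g 1 j + g i 2 * g 2 j)"
proof -
  have "i < 6" "j < 6" using assms by auto
  from hermitian_hadamardD(3)[OF g this]
  have "g i 0 * g 0 j + g i 1 * g 1 j + g i 2 * g 2 j + g i 3 * g 3 j + g i 4 * g 4 j + g i 5 * g 5 j =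
    (if i = j then 6 else 0)"
    unfolding sum_lessThan_6 by simp
  moreover have "g 3 j = cnj (g j 3)" "g 4 j = cnj (g j 4)" "g 5 j = cnj (g j 5)"
    using \<open>j < 6\<close> by (intro hermitian_hadamardD(1)[OF g]; simp)+
  ultimately show ?thesis by (simp add: algebra_simps)
qed

text \<open>Links the nine inner products of three rows to the squared moduli of their column sums.
  For \<open>u = 1\<close> this contradicts positivity; for \<open>u = -1\<close> it yields the
  common row sum's modulus.\<close>

lemma gram_sum_3:
  fixes x y z :: "'a \<Rightarrow> complex"
  shows "(\<Sum>k\<in>K. (x k + y k + z k) * cnj (x k + y k + z k)) =
    (\<Sum>k\<in>K. x k * cnj (x k)) + (\<Sum>k\<in>K. y k * cnj (y k)) + (\<Sum>k\<in>K. z k * cnj (z k)) +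
    (\<Sum>k\<in>K. x k * cnj (y k)) + (\<Sum>k\<in>K. y k * cnj (x k)) + (\<Sum>k\<in>K. x k * cnj (z k)) +
    (\<Sum>k\<in>K. z k * cnj (x k)) + (\<Sum>k\<in>K. y k * cnj (z k)) + (\<Sum>k\<in>K. z k * cnj (y k))"
  unfolding sum.distrib[symmetric] by (intro sum.cong refl) (simp add: algebra_simps)

text \<open>For \<open>u = 1\<close> the sum of all entries of the Gram matrix of the rows of \<open>B\<close> would be negative.\<close>

lemma circulant_diagonal_blocks_ne_1:
  assumes g: "hermitian_hadamard 6 g"
  shows "\<not> circulant_diagonal_blocks 1 g"
proof
  assume c: "circulant_diagonal_blocks 1 g"
  note r = circulant_diagonal_blocks_entries[OF g c]
  define K where "K = {3, 4, 5::nat}"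
  \<comment> \<open>Here \<open>A\<close> is the all-ones matrix \<open>J\<close>, so the Gram
    matrix is \<open>6 - 3 J\<close>. Its entries add up to 9 - 18 = -9.\<close>
  have P: "(\<Sum>k\<in>K. g i k * cnj (g j k)) = (if i = j then 3 else -3)" if "i \<in> {0,1,2}" "j \<in> {0,1,2}" for i j
    using gram_upper_right[OF g, of i j] that unfolding insert_iff empty_iff
    by (elim disjE) (simp_all add: r r[unfolded One_nat_def] add.assoc K_def)
  have "(\<Sum>k\<in>K. (g 0 k + g 1 k + g 2 k) * cnj (g 0 k + g 1 k + g 2 k)) = -9"
    unfolding gram_sum_3 by (simp add: P)
  then have "complex_of_real (\<Sum>k\<in>K. (cmod (g 0 k + g 1 k + g 2 k))\<^sup>2) = of_real (-9)"
    by (simp only: complex_norm_square of_real_sum) simp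
  then have "(\<Sum>k\<in>K. (cmod (g 0 k + g 1 k + g 2 k))\<^sup>2) = -9"
    by (simp only: of_real_eq_iff)
  moreover have "(\<Sum>k\<in>K. (cmod (g 0 k + g 1 k + g 2 k))\<^sup>2) \<ge> 0"
    by (rule sum_nonneg) simp
  ultimately show False by linarith
qed

text \<open>Conjugating the sum shows that \<open>p q + p r + q r = p q r\<close>. Hence 1 is a root
  of the monic cubic with roots \<open>p\<close>, \<open>q\<close>, \<open>r\<close>.\<close>

lemma unimodular_sum_3_eq_1:
  assumes "cmod p = 1" "cmod q = 1" "cmod r = 1" "p + q + r = 1"
  shows "p = 1 \<or> q = 1 \<or> r = 1"
proof -
  note u = cnj_unimodular[OF assms(1)] cnj_unimodular[OF assms(2)] cnj_unimodular[OF assms(3)]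
  have c: "cnj p + cnj q + cnj r = 1" using arg_cong[OF assms(4), of cnj] by simp
  have "(1 - p) * (1 - q) * (1 - r) = 0"
    using u c assms(4) by Groebner_Basis.algebra
  then show ?thesis by simp
qed

lemma eq_of_mult_cnj_eq_1:
  assumes "cmod x = 1" "x * cnj y = 1"
  shows "x = y"
proof -
  have "x * cnj x = x * cnj y" "x \<noteq> 0" using assms cnj_unimodular by auto
  then show ?thesis by simp
qed

text \<open>Two unimodular numbers with nonzero sum are determined by it up to order, because the
  sum and its conjugate determine the product. Orthogonality excludes the unchanged order, and the
  modulus of the full sum then forces \<open>x\<close> to equal \<open>y\<close> or
  \<open>z\<close>.\<close>

lemma unimodular_swap:
  assumes n: "cmod x = 1" "cmod y = 1" "cmod z = 1" "cmod y' = 1" "cmod z' = 1"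
    and orth: "y * cnj y' + z * cnj z' = 0" and sum: "y + z = y' + z'"
    and five: "(x + y + z) * cnj (x + y + z) = 5"
  shows "y' = z \<and> z' = y \<and> (x = y \<or> x = z)"
proof -
  note u = n[THEN cnj_unimodular]
  have yz: "y + z \<noteq> 0"
  proof
    assume "y + z = 0"
    then have "x + y + z = x" by (simp add: add.assoc)
    from five[unfolded this] u(1) show False by simp
  qed
  have csum: "cnj y + cnj z = cnj y' + cnj z'" using arg_cong[OF sum, of cnj] by simp
  have "(y + z) * (y * z - y' * z') = 0"
    using u csum sum by Groebner_Basis.algebra
  then have p: "y * z = y' * z'" using yz by simp
  have "(y' - y) * (y' - z) = 0" using p sum by Groebner_Basis.algebra
  then have "y' = y \<or> y' = z" by simp
  moreover have "y' \<noteq> y"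
  proof
    assume "y' = y"
    moreover from this have "z' = z" using sum by simp
    ultimately show False using orth u by simp
  qed
  ultimately have sw: "y' = z" "z' = y" using sum by auto
  have "y * cnj z + z * cnj y = 0" using orth unfolding sw .
  moreover have "(x + y + z) * (cnj x + cnj y + cnj z) = 5" using five by simp
  ultimately have "(x - y) * (x - z) * 2 = 0"
    using u by Groebner_Basis.algebra
  then show ?thesis using sw by simp
qed

text \<open>The inner product is a sum of three unimodular numbers equal to 1, so the rows agree in
  one coordinate. The other two coordinates are then exchanged by
  \<open>unimodular_swap\<close>.\<close>

lemma unimodular_rows:
  assumes n: "cmod x = 1" "cmod y = 1" "cmod z = 1" "cmod x' = 1" "cmod y' = 1" "cmod z' = 1"
    and inner: "x * cnj x' + y * cnj y' + z * cnj z' = 1"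
    and sum: "x + y + z = s" "x' + y' + z' = s" and five: "s * cnj s = 5"
  shows "x' = x \<and> y' = z \<and> z' = y \<and> (x = y \<or> x = z) \<or>
    y' = y \<and> x' = z \<and> z' = x \<and> (y = x \<or> y = z) \<or>
    z' = z \<and> x' = y \<and> y' = x \<and> (z = x \<or> z = y)"
proof -
  have "x * cnj x' = 1 \<or> y * cnj y' = 1 \<or> z * cnj z' = 1"
    by (rule unimodular_sum_3_eq_1) (use n inner in \<open>simp_all add: norm_mult\<close>)
  then show ?thesis
  proof (elim disjE)
    assume 1: "x * cnj x' = 1"
    then have x: "x = x'" using n eq_of_mult_cnj_eq_1 by blast
    have "y' = z \<and> z' = y \<and> (x = y \<or> x = z)"
    proof (rule unimodular_swap)
      show "y * cnj y' + z * cnj z' = 0" using inner 1 by (simp add: add.assoc)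
      show "y + z = y' + z'" using sum(1)[folded sum(2)] x by (simp add: ac_simps)
      show "(x + y + z) * cnj (x + y + z) = 5" unfolding sum by (rule five)
    qed (use n in simp_all)
    with x show ?thesis by simp
  next
    assume 1: "y * cnj y' = 1"
    then have y: "y = y'" using n eq_of_mult_cnj_eq_1 by blast
    have s': "y + x + z = s" using sum(1) by (simp add: add.commute)
    have "x' = z \<and> z' = x \<and> (y = x \<or> y = z)"
    proof (rule unimodular_swap)
      show "x * cnj x' + z * cnj z' = 0" using inner unfolding 1 by (simp add: ac_simps)
      show "x + z = x' + z'" using sum(1)[folded sum(2)] y by (simp add: ac_simps)
      show "(y + x + z) * cnj (y + x + z) = 5" unfolding s' by (rule five)
    qed (use n in simp_all)
    with y show ?thesis by simp
  next
    assume 1: "z * cnj z' = 1"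
    then have z: "z = z'" using n eq_of_mult_cnj_eq_1 by blast
    have s': "z + x + y = s" using sum(1) by (simp add: add.commute add.left_commute)
    have "x' = y \<and> y' = x \<and> (z = x \<or> z = y)"
    proof (rule unimodular_swap)
      show "x * cnj x' + y * cnj y' = 0" using inner unfolding 1 by (simp add: ac_simps)
      show "x + y = x' + y'" using sum(1)[folded sum(2)] z by (simp add: ac_simps)
      show "(z + x + y) * cnj (z + x + y) = 5" unfolding s' by (rule five)
    qed (use n in simp_all)
    with z show ?thesis by simp
  qed
qed

text \<open>Three distinct rows related in this way are the three arrangements of one triple
  \<open>(a, a, b)\<close>. They form a circulant matrix either in the given order or after
  exchanging the first two.\<close>

lemma swapped_rows_circulant:
  assumes "x' = x \<and> y' = z \<and> z' = y \<and> (x = y \<or> x = z) \<or>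
    y' = y \<and> x' = z \<and> z' = x \<and> (y = x \<or> y = z) \<or>
    z' = z \<and> x' = y \<and> y' = x \<and> (z = x \<or> z = y)"
    and "x'' = x \<and> y'' = z \<and> z'' = y \<and> (x = y \<or> x = z) \<or>
    y'' = y \<and> x'' = z \<and> z'' = x \<and> (y = x \<or> y = z) \<or>
    z'' = z \<and> x'' = y \<and> y'' = x \<and> (z = x \<or> z = y)"
    and "\<not> (x = x' \<and> y = y' \<and> z = z')" "\<not> (x = x'' \<and> y = y'' \<and> z = z'')"
    "\<not> (x' = x'' \<and> y' = y'' \<and> z' = z'')"
  shows "y' = x \<and> z'' = x \<and> z' = y \<and> x'' = y \<and> x' = z \<and> y'' = z \<or>
    y = x' \<and> z'' = x' \<and> z = y' \<and> x'' = y' \<and> x = z' \<and> y'' = z'"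
  using assms by metis

lemma unimodular_rows_circulant:
  fixes b :: "nat \<Rightarrow> nat \<Rightarrow> complex"
  assumes n: "\<And>i j. i < 3 \<Longrightarrow> j < 3 \<Longrightarrow> cmod (b i j) = 1"
    and inner: "\<And>i j. i < 3 \<Longrightarrow> j < 3 \<Longrightarrow> i \<noteq> j \<Longrightarrow>
      b i 0 * cnj (b j 0) + b i 1 * cnj (b j 1) + b i 2 * cnj (b j 2) = 1"
    and sum: "\<And>i. i < 3 \<Longrightarrow> b i 0 + b i 1 + b i 2 = s" and five: "s * cnj s = 5"
  shows "(\<forall>i<3. \<forall>j<3. b ((i + 1) mod 3) ((j + 1) mod 3) = b i j) \<or>
    (\<forall>i<3. \<forall>j<3. b (transpose 0 1 ((i + 1) mod 3)) ((j + 1) mod 3) = b (transpose 0 1 i) j)"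
proof -
  have R: "b j 0 = b i 0 \<and> b j 1 = b i 2 \<and> b j 2 = b i 1 \<and> (b i 0 = b i 1 \<or> b i 0 = b i 2) \<or>
    b j 1 = b i 1 \<and> b j 0 = b i 2 \<and> b j 2 = b i 0 \<and> (b i 1 = b i 0 \<or> b i 1 = b i 2) \<or>
    b j 2 = b i 2 \<and> b j 0 = b i 1 \<and> b j 1 = b i 0 \<and> (b i 2 = b i 0 \<or> b i 2 = b i 1)"
    if "i < 3" "j < 3" "i \<noteq> j" for i j
    by (rule unimodular_rows[OF _ _ _ _ _ _ inner[OF that] sum[OF that(1)] sum[OF that(2)] five])
      (use that n in simp_all)
  have same: "\<not> (b i 0 = b j 0 \<and> b i 1 = b j 1 \<and> b i 2 = b j 2)" if "i < 3" "j < 3" "i \<noteq> j" for i j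
  proof
    assume "b i 0 = b j 0 \<and> b i 1 = b j 1 \<and> b i 2 = b j 2"
    then show False
      using inner[OF that] cnj_unimodular[OF n[OF that(2)]] by simp
  qed
  have l: "0 < (3::nat)" "1 < (3::nat)" "2 < (3::nat)" "0 \<noteq> (1::nat)" "0 \<noteq> (2::nat)" "1 \<noteq> (2::nat)"
    by simp_all
  have t: "transpose 0 1 0 = (1::nat)" "transpose 0 1 1 = (0::nat)" "transpose 0 1 2 = (2::nat)"
    by simp_all
  note * = swapped_rows_circulant[OF R[OF l(1,2,4)] R[OF l(1,3,5)] same[OF l(1,2,4)] same[OF l(1,3,5)] same[OF l(2,3,6)]]
  show ?thesis unfolding all_less_3 shift_mod_3 t using * by metis
qed

text \<open>With \<open>J\<close> the all-ones matrix, \<open>A = 2 - J\<close> and hence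
  \<open>B B* = 2 + J\<close>. This supplies the inner products required by
  \<open>unimodular_rows_circulant\<close>.\<close>

lemma degenerate_block_circulant:
  assumes g: "hermitian_hadamard 6 g" and c: "circulant_diagonal_blocks (-1) g"
  shows "\<exists>f. phase_perm_congruent 6 g f \<and> block_circulant f"
proof -
  note r = circulant_diagonal_blocks_entries[OF g c]
  define b where "b i j = g i (3 + j)" for i j
  have b: "b i 0 = g i 3" "b i 1 = g i 4" "b i 2 = g i 5" for i unfolding b_def by simp_all
  have inner: "b i 0 * cnj (b j 0) + b i 1 * cnj (b j 1) + b i 2 * cnj (b j 2) = (if i = j then 3 else 1)"
    if "i < 3" "j < 3" for i j
    using gram_upper_right[OF g that] that unfolding b less_3_iff
    by (elim disjE) (simp_all add: r r[unfolded One_nat_def])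
  \<comment> \<open>Commuting with \<open>2 - J\<close> means commuting with \<open>J\<close>, so
    every row sum equals every column sum.\<close>
  have rc: "b i 0 + b i 1 + b i 2 = b 0 j + b 1 j + b 2 j" if "i < 3" "j < 3" for i j
    using commute_circulant_diagonal_blocks[OF g c, rule_format, OF that] that
    unfolding b_def[symmetric] less_3_iff
    by (elim disjE) (simp_all add: numeral_2_eq_2 algebra_simps)
  define s where "s = b 0 0 + b 0 1 + b 0 2"
  have col: "b 0 j + b 1 j + b 2 j = s" if "j < 3" for j using rc[of 0 j] that unfolding s_def by simp
  have row: "b i 0 + b i 1 + b i 2 = s" if "i < 3" for i using rc[OF that, of 0] col[of 0] by simp
  define K where "K = {0, 1, 2::nat}"
  have P: "(\<Sum>k\<in>K. b i k * cnj (b j k)) = (if i = j then 3 else 1)" if "i < 3" "j < 3" for i j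
    using inner[OF that] unfolding K_def by (simp add: add.assoc)
  \<comment> \<open>The entries of \<open>2 + J\<close> add up to 9 + 6 = 15. All three column sums
    are \<open>s\<close>, so this is three times \<open>s * cnj s\<close>.\<close>
  have "(\<Sum>k\<in>K. (b 0 k + b 1 k + b 2 k) * cnj (b 0 k + b 1 k + b 2 k)) = 15"
    unfolding gram_sum_3 by (simp add: P)
  moreover have "(\<Sum>k\<in>K. (b 0 k + b 1 k + b 2 k) * cnj (b 0 k + b 1 k + b 2 k)) = (\<Sum>k\<in>K. s * cnj s)"
  proof (intro sum.cong refl)
    fix k assume "k \<in> K"
    then have "k < 3" unfolding K_def by auto
    then show "(b 0 k + b 1 k + b 2 k) * cnj (b 0 k + b 1 k + b 2 k) = s * cnj s" by (simp only: col)
  qed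
  ultimately have five: "s * cnj s = 5" unfolding K_def by simp
  have "cmod (b i j) = 1" if "i < 3" "j < 3" for i j
    unfolding b_def by (rule hermitian_hadamardD(2)[OF g]) (use that in auto)
  from unimodular_rows_circulant[of b, OF this _ row five] inner
  consider "\<forall>i<3. \<forall>j<3. b ((i + 1) mod 3) ((j + 1) mod 3) = b i j" |
    "\<forall>i<3. \<forall>j<3. b (transpose 0 1 ((i + 1) mod 3)) ((j + 1) mod 3) = b (transpose 0 1 i) j"
    by auto
  then show ?thesis
  proof cases
    case 1
    have "phase_perm_congruent 6 g g" using phase_perm_congruent_permute[of id 6 g] by (simp add: permutes_id)
    then show ?thesis using block_circulantI[OF g c 1[unfolded b_def]] by blast
  next
    case 2
    \<comment> \<open>For \<open>u = -1\<close> all off-diagonal entries of \<open>A\<close>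
      coincide, so exchanging the indices 0 and 1 preserves both diagonal blocks and only reorders
      the rows of \<open>B\<close>.\<close>
    define \<tau> where "\<tau> = transpose 0 (1::nat)"
    define f where "f i j = g (\<tau> i) (\<tau> j)" for i j
    have "\<tau> permutes {..<6}" unfolding \<tau>_def by (rule permutes_swap_id) auto
    then have gf: "phase_perm_congruent 6 g f" unfolding f_def by (rule phase_perm_congruent_permute)
    then have f: "hermitian_hadamard 6 f" by (rule hermitian_hadamard_congruent[OF g])
    have \<tau>: "\<tau> 0 = 1" "\<tau> 1 = 0" "\<tau> 2 = 2" "\<tau> 3 = 3" "\<tau> 4 = 4" "\<tau> 5 = 5" unfolding \<tau>_def by simp_all
    have cf: "circulant_diagonal_blocks (-1) f"
      unfolding circulant_diagonal_blocks_def all_less_3 shift_mod_3 f_def \<tau> r by simp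
    have "\<tau> (3 + k) = 3 + k" for k unfolding \<tau>_def by simp
    then have "\<forall>i<3. \<forall>j<3. f ((i + 1) mod 3) (3 + (j + 1) mod 3) = f i (3 + j)"
      using 2 unfolding f_def b_def \<tau>_def by simp
    then show ?thesis using block_circulantI[OF f cf] gf by blast
  qed
qed

section \<open>Combining the cases\<close>

lemma circulant_diagonal_blocks_block_circulant:
  assumes g: "hermitian_hadamard 6 g" and c: "circulant_diagonal_blocks u g" and u: "cmod u = 1"
    and u3: "u ^ 3 = 1 \<longrightarrow> u = 1" "u ^ 3 = -1 \<longrightarrow> u = -1"
  shows "\<exists>f. phase_perm_congruent 6 g f \<and> block_circulant f"
proof (cases "u ^ 6 = 1")
  case True
  then have "u = 1 \<or> u = -1" using u3 power2_eq_1_iff[of "u ^ 3"] by auto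
  then show ?thesis
    using circulant_diagonal_blocks_ne_1[OF g] degenerate_block_circulant[OF g] c by auto
next
  case False
  have "\<forall>i<3. \<forall>j<3. g ((i + 1) mod 3) (3 + (j + 1) mod 3) = g i (3 + j)"
    by (rule circulant_of_commute_circulant[OF cnj_unimodular[OF u] False])
      (rule commute_circulant_diagonal_blocks[OF g c])
  then have "block_circulant g" by (rule block_circulantI[OF g c])
  moreover have "phase_perm_congruent 6 g g"
    using phase_perm_congruent_permute[of id 6 g] by (simp add: permutes_id)
  ultimately show ?thesis by blast
qed

lemma signed_diagonal_block_circulant:
  assumes g: "hermitian_hadamard 6 g"
    and dg: "\<forall>i<3. g i i = 1 \<and> g (3 + i) (3 + i) = -1"
  shows "\<exists>f. phase_perm_congruent 6 g f \<and> block_circulant f"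
proof -
  have main: "\<exists>f. phase_perm_congruent 6 h f \<and> block_circulant f"
    if h: "hermitian_hadamard 6 h"
      and "\<forall>i<3. h i i = 1 \<and> h (3 + i) (3 + i) = -1"
      and "h 3 4 * h 4 5 * h 5 3 = - (h 0 1 * h 1 2 * h 2 0)" for h
  proof -
    from rescale_to_circulant[OF that] obtain u f where hf: "phase_perm_congruent 6 h f"
      and f: "circulant_diagonal_blocks u f" "cmod u = 1" "u ^ 3 = 1 \<longrightarrow> u = 1" "u ^ 3 = -1 \<longrightarrow> u = -1"
      by blast
    from circulant_diagonal_blocks_block_circulant[OF hermitian_hadamard_congruent[OF h hf] f]
    show ?thesis using phase_perm_congruent_trans[OF hf] by blast
  qed
  let ?s = "g 0 1 * g 1 2 * g 2 0" and ?t = "g 3 4 * g 4 5 * g 5 3"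
  have n: "cmod (g i j) = 1" if "i < 6" "j < 6" for i j using hermitian_hadamardD(2)[OF g that] .
  have "?t = - ?s \<or> ?t = cnj (- ?s)"
  proof (rule cnj_eq_or_eq_of_Re_eq)
    show "cmod ?t = 1" "cmod (- ?s) = 1" by (simp_all add: norm_mult n)
    show "Re ?t = Re (- ?s)" unfolding uminus_complex.sel Re_triple_products_opposite[OF g dg] by simp
  qed
  then show ?thesis
  proof
    assume "?t = - ?s"
    then show ?thesis by (rule main[OF g dg])
  next
    assume t: "?t = cnj (- ?s)"
    \<comment> \<open>Exchanging the indices 3 and 4 reverses the orientation of the lower triple,
      which conjugates its cyclic product and leads back to the first case.\<close>
    define \<tau> where "\<tau> = transpose 3 (4::nat)"
    define h where "h i j = g (\<tau> i) (\<tau> j)" for i j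
    have \<tau>: "\<tau> 0 = 0" "\<tau> 1 = 1" "\<tau> 2 = 2" "\<tau> 3 = 4" "\<tau> 4 = 3" "\<tau> 5 = 5" unfolding \<tau>_def by simp_all
    have "\<tau> permutes {..<6}" unfolding \<tau>_def by (rule permutes_swap_id) auto
    then have gh: "phase_perm_congruent 6 g h" unfolding h_def by (rule phase_perm_congruent_permute)
    then have h: "hermitian_hadamard 6 h" by (rule hermitian_hadamard_congruent[OF g])
    have "g 4 3 = cnj (g 3 4)" "g 3 5 = cnj (g 5 3)" "g 5 4 = cnj (g 4 5)"
      by (intro hermitian_hadamardD(1)[OF g]; simp)+
    then have "h 3 4 * h 4 5 * h 5 3 = cnj ?t" unfolding h_def \<tau> by simp
    also have "\<dots> = - (h 0 1 * h 1 2 * h 2 0)" unfolding t h_def \<tau> by simp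
    finally have "h 3 4 * h 4 5 * h 5 3 = - (h 0 1 * h 1 2 * h 2 0)" .
    moreover have "\<forall>i<3. h i i = 1 \<and> h (3 + i) (3 + i) = -1"
      using dg unfolding all_less_3 shift_mod_3 h_def \<tau> by simp
    ultimately show ?thesis using main[OF h] phase_perm_congruent_trans[OF gh] by blast
  qed
qed

theorem corollary3p7:
  fixes H :: "complex mat"
  assumes "complex_hadamard 6 H"
    and "mat_adjoint H = H"
  shows "has_two_circulant_representation H"
proof -
  let ?h = "\<lambda>i j. H $$ (i, j)"
  have h: "hermitian_hadamard 6 ?h" using assms by (rule hermitian_hadamard_index)
  from diagonal_signs[OF h trace_hermitian_hadamard_6[OF assms]] obtain g where hg: "phase_perm_congruent 6 ?h g"
    and dg: "\<forall>i<3. g i i = 1 \<and> g (3 + i) (3 + i) = -1" by blast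
  from signed_diagonal_block_circulant[OF hermitian_hadamard_congruent[OF h hg] dg]
  obtain f where gf: "phase_perm_congruent 6 g f" and f: "block_circulant f" by blast
  have hf: "phase_perm_congruent 6 ?h f" using hg gf by (rule phase_perm_congruent_trans)
  let ?K = "mat 6 6 (\<lambda>(i, j). f i j)"
  have "complex_hadamard 6 ?K"
    by (rule complex_hadamard_mat[OF hermitian_hadamard_congruent[OF h hf]])
  moreover have "two_circulant ?K" using f by (rule two_circulant_mat)
  moreover have "hadamard_equivalent 6 H ?K"
    using assms(1) hf by (intro hadamard_equivalent_congruent) (simp_all add: complex_hadamard_def)
  ultimately show ?thesis unfolding has_two_circulant_representation_def by blast
qed

end
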